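(* For any circle graph $G=(V,E)$, $\psi(G) \ge an(G)$.
   Context: A circle graph is the intersection graph of a finite set of chords of a circle. For $k \ge 3$, a $k$-polygon graph is the intersection graph of a finite set of chords of a convex $k$-sided polygon with each chord having its endpoints on two distinct sides; $2$-polygon graphs are the permutation graphs. The polygon number $\psi(G)$ of a circle graph $G$ is the minimum $k\ge 2$ such that $G$ is a $k$-polygon graph. A set $A \subseteq V$ is an asteroidal set if for every $a \in A$, every two vertices $x,y \in A\setminus\{a\}$ are joined by a path in $G - N[a]$ (where $N[a]$ is the closed neighbourhood of $a$). The asteroidal number $an(G)$ is the maximum cardinality of an asteroidal set of $G$. *)

theory Defs
  imports "HOL-Analysis.Analysis" "Graph_Theory.Digraph_Component" "HOL-Combinatorics.Permutations"
begin

text \<open>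
  Finite simple graphs are the symmetric, loop-free digraphs without parallel arcs of the
  locale \<^locale>\<open>graph\<close>.
\<close>

definition intersection_graph_of :: "('a, 'b) pre_digraph \<Rightarrow> 'c set set \<Rightarrow> bool" where
  "intersection_graph_of G S \<longleftrightarrow> graph G \<and>
     (\<exists>f. bij_betw f (verts G) S \<and>
        (\<forall>u \<in> verts G. \<forall>v \<in> verts G. u \<noteq> v \<longrightarrow> (u \<rightarrow>\<^bsub>G\<^esub> v \<longleftrightarrow> f u \<inter> f v \<noteq> {})))"

text \<open>Chords are closed segments, so two chords with a common endpoint intersect.\<close>

definition circle_chord :: "real^2 \<Rightarrow> real \<Rightarrow> (real^2) set \<Rightarrow> bool" where
  "circle_chord c r s \<longleftrightarrow>
     (\<exists>a \<in> sphere c r. \<exists>b \<in> sphere c r. a \<noteq> b \<and> s = closed_segment a b)"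

definition circle_graph :: "('a, 'b) pre_digraph \<Rightarrow> bool" where
  "circle_graph G \<longleftrightarrow>
     (\<exists>c r S. r > 0 \<and> finite S \<and> (\<forall>s \<in> S. circle_chord c r s) \<and> intersection_graph_of G S)"

definition convex_polygon :: "nat \<Rightarrow> (real^2) set \<Rightarrow> bool" where
  "convex_polygon k P \<longleftrightarrow> polytope P \<and> aff_dim P = 2 \<and> card {F. F facet_of P} = k"

text \<open>
  The sides are closed segments: a corner lies on both of its sides and may be an endpoint.
\<close>

definition polygon_chord :: "(real^2) set \<Rightarrow> (real^2) set \<Rightarrow> bool" where
  "polygon_chord P s \<longleftrightarrow>
     (\<exists>F1 F2 a b. F1 facet_of P \<and> F2 facet_of P \<and> F1 \<noteq> F2 \<and>
        a \<in> F1 \<and> b \<in> F2 \<and> a \<noteq> b \<and> s = closed_segment a b)"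

text \<open>
  The vertices are numbered by \<open>f\<close>; two are adjacent iff the permutation \<open>p\<close> inverts
  the order of their numbers.
\<close>

definition permutation_graph :: "('a, 'b) pre_digraph \<Rightarrow> bool" where
  "permutation_graph G \<longleftrightarrow> graph G \<and>
     (\<exists>f p. bij_betw f (verts G) {..<card (verts G)} \<and> p permutes {..<card (verts G)} \<and>
        (\<forall>u \<in> verts G. \<forall>v \<in> verts G. u \<rightarrow>\<^bsub>G\<^esub> v \<longleftrightarrow>
           (f u < f v \<and> p (f v) < p (f u)) \<or> (f v < f u \<and> p (f u) < p (f v))))"

definition polygon_graph :: "nat \<Rightarrow> ('a, 'b) pre_digraph \<Rightarrow> bool" where
  "polygon_graph k G \<longleftrightarrow>
     (k = 2 \<and> permutation_graph G) \<or>
     (k \<ge> 3 \<and> (\<exists>P S. convex_polygon k P \<and> finite S \<and> (\<forall>s \<in> S. polygon_chord P s) \<and>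
        intersection_graph_of G S))"

text \<open>
  Meaningful for circle graphs only: each of them is a \<open>k\<close>-polygon graph for some \<open>k \<ge> 2\<close>.
\<close>

definition polygon_number :: "('a, 'b) pre_digraph \<Rightarrow> nat" where
  "polygon_number G = (LEAST k. k \<ge> 2 \<and> polygon_graph k G)"

definition closed_neighbourhood :: "('a, 'b) pre_digraph \<Rightarrow> 'a \<Rightarrow> 'a set" where
  "closed_neighbourhood G a = insert a {v \<in> verts G. a \<rightarrow>\<^bsub>G\<^esub> v}"

text \<open>
  ``Every two vertices'' means two distinct ones, so a set of at most two vertices is
  always asteroidal.
\<close>

definition asteroidal_set :: "('a, 'b) pre_digraph \<Rightarrow> 'a set \<Rightarrow> bool" where
  "asteroidal_set G A \<longleftrightarrow> A \<subseteq> verts G \<and>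
     (\<forall>a \<in> A. \<forall>x \<in> A - {a}. \<forall>y \<in> A - {a}. x \<noteq> y \<longrightarrow>
        (\<exists>p. pre_digraph.apath (G \<restriction> (verts G - closed_neighbourhood G a)) x p y))"

definition asteroidal_number :: "('a, 'b) pre_digraph \<Rightarrow> nat" where
  "asteroidal_number G = Max (card ` {A. asteroidal_set G A})"

end

theory Submission
  imports Defs
begin

text \<open>
  Let \<open>A\<close> be an asteroidal set with at least three elements. The chord of \<open>a \<in> A\<close> cuts the polygon
  in two, and since the chords of \<open>A - {a}\<close> are joined by chains of chords avoiding it, they all lie
  in one part; let \<open>R a\<close> be the other part, including the chord itself. A connected set that meets
  \<open>R a\<close> without being contained in it has to cross the chord of \<open>a\<close>; therefore the sets \<open>R a\<close> are
  pairwise disjoint. Each of them contains a corner of the polygon, so \<open>card A\<close> is at most the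
  number of corners, hence at most the number of sides. A chord running along a side separates
  nothing; then \<open>R a\<close> is the chord, which has a corner as an endpoint.

  For permutation graphs, an independent triple is a chain of the product order, and no path avoiding
  the neighbourhood of its middle element joins the other two.

  A circle graph is a polygon graph of some order: take the convex hull of the endpoints of the chords.
\<close>

section \<open>Asteroidal sets\<close>

lemma asteroidal_set_apath:
  assumes "asteroidal_set G A" "a \<in> A" "x \<in> A - {a}" "y \<in> A - {a}" "x \<noteq> y"
  obtains p where "pre_digraph.apath (G \<restriction> (verts G - closed_neighbourhood G a)) x p y"
  using assms unfolding asteroidal_set_def by blast

lemma asteroidal_set_reachable:
  assumes "graph G" "asteroidal_set G A" "a \<in> A" "x \<in> A - {a}" "y \<in> A - {a}" "x \<noteq> y"
  shows "x \<rightarrow>\<^sup>*\<^bsub>G \<restriction> (verts G - closed_neighbourhood G a)\<^esub> y"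
proof -
  interpret graph G by fact
  let ?H = "G \<restriction> (verts G - closed_neighbourhood G a)"
  interpret H: wf_digraph ?H by (rule wellformed_induce_subgraph)
  show ?thesis
    using asteroidal_set_apath[OF assms(2-6)] H.reachable_apath by blast
qed

text \<open>A third element \<open>y\<close> of \<open>A\<close> exists, and the path from
  \<open>x\<close> to \<open>y\<close> that avoids the closed neighbourhood of \<open>a\<close>
  starts at \<open>x\<close>.\<close>

lemma asteroidal_set_not_closed_neighbour:
  assumes "graph G" "asteroidal_set G A" "3 \<le> card A" "a \<in> A" "x \<in> A - {a}"
  shows "x \<in> verts G - closed_neighbourhood G a"
proof -
  interpret graph G by fact
  let ?H = "G \<restriction> (verts G - closed_neighbourhood G a)"
  interpret H: wf_digraph ?H by (rule wellformed_induce_subgraph)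
  have "\<not> A \<subseteq> {a, x}"
  proof
    assume "A \<subseteq> {a, x}"
    then have "card A \<le> card {a, x}"
      by (intro card_mono) auto
    also have "\<dots> \<le> 2"
      by (simp add: card_insert_if)
    finally show False
      using assms(3) by simp
  qed
  then obtain y where "y \<in> A - {a}" "x \<noteq> y"
    by blast
  then show ?thesis
    using H.reachable_in_verts(1)[OF asteroidal_set_reachable[OF assms(1,2,4,5)]] by simp
qed

text \<open>Induction along a path that avoids the closed neighbourhood of \<open>a\<close>. It
  serves to carry "below \<open>y\<close>" through a permutation graph and "misses \<open>R\<close>"
  through a family of chords.\<close>

lemma asteroidal_set_induct:
  assumes "graph G" "asteroidal_set G A" "a \<in> A" "x \<in> A - {a}" "y \<in> A - {a}"
    and base: "Q x"
    and step: "\<And>v w. v \<in> verts G - closed_neighbourhood G a \<Longrightarrow>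
      w \<in> verts G - closed_neighbourhood G a \<Longrightarrow> v \<rightarrow>\<^bsub>G\<^esub> w \<Longrightarrow> Q v \<Longrightarrow> Q w"
  shows "Q y"
proof (cases "x = y")
  case False
  interpret graph G by fact
  let ?H = "G \<restriction> (verts G - closed_neighbourhood G a)"
  interpret H: wf_digraph ?H by (rule wellformed_induce_subgraph)
  show ?thesis
    using asteroidal_set_reachable[OF assms(1-5) False]
  proof (induction rule: H.reachable_induct)
    case (step v w)
    then have "v \<rightarrow>\<^bsub>G\<^esub> w"
      by (rule_tac dominates_induce_subgraphD)
    then show ?case
      using assms(7)[of v w] H.adj_in_verts[OF step(2)] step(3) by simp
  qed (rule base)
qed (use base in simp)

section \<open>Permutation graphs\<close>

lemma permutation_graph_asteroidal:
  assumes "permutation_graph G" "asteroidal_set G A"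
  shows "card A \<le> 2"
proof (rule ccontr)
  assume "\<not> card A \<le> 2"
  then have card: "3 \<le> card A" by simp
  from assms(1) obtain f p where G: "graph G"
    and f: "bij_betw f (verts G) {..<card (verts G)}"
    and p: "p permutes {..<card (verts G)}"
    and adj: "\<And>u v. u \<in> verts G \<Longrightarrow> v \<in> verts G \<Longrightarrow> u \<rightarrow>\<^bsub>G\<^esub> v \<longleftrightarrow>
      (f u < f v \<and> p (f v) < p (f u)) \<or> (f v < f u \<and> p (f u) < p (f v))"
    unfolding permutation_graph_def by blast
  have A: "A \<subseteq> verts G"
    using assms(2) by (simp add: asteroidal_set_def)
  have inj: "f u \<noteq> f v" if "u \<in> verts G" "v \<in> verts G" "u \<noteq> v" for u v
    using f that by (auto simp: bij_betw_def inj_on_def)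
  have pinj: "p i \<noteq> p j" if "i \<noteq> j" for i j
    using permutes_inj[OF p] that by (auto dest: injD)
  obtain B where B: "B \<subseteq> A" "card B = 3"
    by (rule obtain_subset_with_card_n[OF card])
  then obtain u v w where uvw: "B = {u, v, w}" "u \<noteq> v" "v \<noteq> w" "u \<noteq> w"
    by (auto simp: card_3_iff)
  then have "f u \<noteq> f v" "f v \<noteq> f w" "f u \<noteq> f w"
    using B A inj by auto
  then have "\<exists>x y z. {x, y, z} = B \<and> f x < f y \<and> f y < f z"
    unfolding uvw(1) by (metis insert_commute nat_neq_iff)
  then obtain x y z where xyz: "{x, y, z} = B" "f x < f y" "f y < f z"
    by blast
  have mem: "y \<in> A" "x \<in> A - {y}" "z \<in> A - {y}"
    using xyz B by auto
  have "f z < f y"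
  proof (rule asteroidal_set_induct[OF G assms(2) mem, where Q = "\<lambda>v. f v < f y"])
    fix v w
    assume "v \<in> verts G - closed_neighbourhood G y" "w \<in> verts G - closed_neighbourhood G y"
      and vw: "v \<rightarrow>\<^bsub>G\<^esub> w" "f v < f y"
    then have v: "v \<in> verts G" "\<not> y \<rightarrow>\<^bsub>G\<^esub> v" "v \<noteq> y"
      and w: "w \<in> verts G" "\<not> y \<rightarrow>\<^bsub>G\<^esub> w" "w \<noteq> y"
      by (auto simp: closed_neighbourhood_def)
    have y: "y \<in> verts G"
      using mem A by auto
    \<comment> \<open>A vertex that is neither \<open>y\<close> nor adjacent to \<open>y\<close> is
      ordered the same way relative to \<open>y\<close> by \<open>f\<close> and by \<open>p\<close>.
      If \<open>w\<close> were above \<open>y\<close>, then \<open>v\<close> would precede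
      \<open>w\<close> in both orders, so \<open>p\<close> would not invert them.\<close>
    show "f w < f y"
      using adj[OF y v(1)] adj[OF y w(1)] adj[OF v(1) w(1)] vw v w
        inj[OF w(1) y w(3)] pinj[of "f w" "f y"] pinj[of "f v" "f y"] by linarith
  qed (rule xyz)
  then show False
    using xyz by simp
qed

section \<open>Corners and sides of a polygon\<close>

lemma finite_extreme_points:
  fixes P :: "'a :: euclidean_space set"
  assumes "polytope P"
  shows "finite {v. v extreme_point_of P}"
  using finite_polyhedron_extreme_points[OF polytope_imp_polyhedron[OF assms]] .

text \<open>Two distinct one-dimensional faces meet in a face of smaller dimension. Being nonempty,
  it is a single point, and a one-point face is an extreme point.\<close>

lemma common_point_of_sides_extreme:
  assumes "aff_dim P = 2" "F facet_of P" "F' facet_of P" "F \<noteq> F'" "v \<in> F" "v \<in> F'"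
    and "convex P"
  shows "v extreme_point_of P"
proof -
  have F: "F face_of P" "F' face_of P" "aff_dim F = 1" "aff_dim F' = 1"
    using assms by (auto simp: facet_of_def)
  then have conv: "convex F" "convex F'"
    by (auto intro: face_of_imp_convex)
  have face: "F \<inter> F' face_of P"
    using F by (simp add: face_of_Int)
  then have "F \<inter> F' face_of F" "F \<inter> F' face_of F'"
    using F by (meson face_of_subset face_of_imp_subset inf_le1 inf_le2)+
  then have "aff_dim (F \<inter> F') < 1"
    using face_of_aff_dim_lt[OF conv(1)] face_of_aff_dim_lt[OF conv(2)] F assms(4) by metis
  moreover have "F \<inter> F' \<noteq> {}"
    using assms(5,6) by auto
  then have "aff_dim (F \<inter> F') \<noteq> -1"
    by (metis aff_dim_empty)
  moreover have "-1 \<le> aff_dim (F \<inter> F')"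
    by (rule aff_dim_geq)
  ultimately have "aff_dim (F \<inter> F') = 0"
    by linarith
  then obtain w where "F \<inter> F' = {w}"
    using aff_dim_eq_0 by metis
  then have "F \<inter> F' = {v}"
    using assms(5,6) by auto
  then show ?thesis
    using face by (simp add: face_of_singleton)
qed

text \<open>A proper nonempty face of a polyhedron is the intersection of the facets containing it.
  With at most one facet at \<open>v\<close>, the face \<open>{v}\<close> would be the whole space
  or a facet, and its dimension 0 is too small for both.\<close>

lemma two_facets_at_extreme_point:
  fixes P :: "'a :: euclidean_space set"
  assumes "polytope P" "2 \<le> aff_dim P" "v extreme_point_of P"
  shows "2 \<le> card {F. F facet_of P \<and> v \<in> F}"
proof (rule ccontr)
  let ?S = "{F. F facet_of P \<and> v \<in> F}"
  assume "\<not> 2 \<le> card ?S"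
  moreover have "finite ?S"
    using finite_polytope_facets[OF assms(1)] by (rule rev_finite_subset) auto
  ultimately have "?S = {} \<or> (\<exists>F. ?S = {F})"
    by (metis One_nat_def card_1_singletonE card_eq_0_iff less_2_cases not_le)
  moreover have "{v} \<noteq> P"
    using assms(2) by auto
  then have "{v} = \<Inter>?S"
    using face_of_polyhedron[of P "{v}"] assms polytope_imp_polyhedron
    by (auto simp: face_of_singleton)
  ultimately have "{v} = UNIV \<or> {v} facet_of P"
    by auto
  then show False
  proof
    assume U: "{v} = UNIV"
    have "aff_dim P \<le> aff_dim {v}"
      by (rule aff_dim_subset) (use U in simp)
    then show False
      using assms(2) by simp
  qed (use assms(2) in \<open>simp add: facet_of_def\<close>)
qed

text \<open>Of three distinct points on a line, one lies strictly between the other two and so is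
  not extreme.\<close>

lemma extreme_points_of_collinear:
  fixes F :: "'a :: euclidean_space set"
  assumes "collinear F" "finite {v. v extreme_point_of F}"
  shows "card {v. v extreme_point_of F} \<le> 2"
proof (rule ccontr)
  assume "\<not> ?thesis"
  then have "3 \<le> card {v. v extreme_point_of F}"
    by simp
  then obtain B where "B \<subseteq> {v. v extreme_point_of F}" "card B = 3"
    by (rule obtain_subset_with_card_n)
  then obtain u v w where uvw: "u extreme_point_of F" "v extreme_point_of F" "w extreme_point_of F"
    "u \<noteq> v" "v \<noteq> w" "u \<noteq> w"
    by (auto simp: card_3_iff)
  then have mem: "u \<in> F" "v \<in> F" "w \<in> F"
    by (auto simp: extreme_point_of_def)
  then have "collinear {u, v, w}"
    using assms(1) by (auto intro: collinear_subset)
  then have "u \<in> open_segment v w \<or> v \<in> open_segment w u \<or> w \<in> open_segment u v"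
    using uvw by (auto simp: collinear_between_cases between_mem_segment open_segment_def)
  then show False
    using uvw mem unfolding extreme_point_of_def by blast
qed

text \<open>Double counting of incident pairs: each corner lies on at least two sides, and each side
  contains at most two corners.\<close>

lemma polygon_corners_le_sides:
  fixes P :: "'a :: euclidean_space set"
  assumes "polytope P" "aff_dim P = 2"
  shows "card {v. v extreme_point_of P} \<le> card {F. F facet_of P}"
proof -
  let ?V = "{v. v extreme_point_of P}" and ?E = "{F. F facet_of P}"
  have fin: "finite ?V" "finite ?E"
    using assms finite_extreme_points finite_polytope_facets by auto
  have two: "card {v \<in> ?V. v \<in> F} \<le> 2" if "F \<in> ?E" for F
  proof -
    have F: "F face_of P" "aff_dim F = 1"
      using that assms by (auto simp: facet_of_def)
    then have eq: "{v. v extreme_point_of F} = {v \<in> ?V. v \<in> F}"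
      by (auto simp: extreme_point_of_face)
    show ?thesis
      using extreme_points_of_collinear[of F] fin(1) F(2)
      by (simp add: eq collinear_aff_dim)
  qed
  have "2 * card ?V = (\<Sum>v\<in>?V. 2)"
    by simp
  also have "\<dots> \<le> (\<Sum>v\<in>?V. card {F \<in> ?E. v \<in> F})"
    using two_facets_at_extreme_point[OF assms(1)] assms(2) by (intro sum_mono) simp
  also have "\<dots> = (\<Sum>F\<in>?E. card {v \<in> ?V. v \<in> F})"
    using fin by (intro sum_multicount_gen) auto
  also have "\<dots> \<le> (\<Sum>F\<in>?E. 2)"
    using two by (intro sum_mono) auto
  finally show ?thesis
    by simp
qed

section \<open>The part cut off by a chord\<close>

text \<open>The plain name \<open>connected\<close> refers to connected graphs here.\<close>

abbreviation connected_set :: "'a :: topological_space set \<Rightarrow> bool" where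
  "connected_set \<equiv> topological_space_class.connected"

lemma line_as_hyperplane:
  fixes s t :: "real^2"
  assumes "s \<noteq> t"
  obtains u d where "u \<bullet> s = d" "u \<bullet> t = d" "\<And>p. u \<bullet> p = d \<Longrightarrow> collinear {s, t, p}"
proof -
  \<comment> \<open>The vector \<open>t - s\<close> turned by a right angle, a normal of the line
    through \<open>s\<close> and \<open>t\<close>.\<close>
  define u :: "real^2" where "u = vector [t$2 - s$2, s$1 - t$1]"
  have u: "u \<bullet> p = (t$2 - s$2) * p$1 + (s$1 - t$1) * p$2" for p
    by (simp add: u_def inner_vec_def sum_2)
  have "collinear {s, t, p}" if "u \<bullet> p = u \<bullet> s" for p
  proof -
    have "\<exists>l. p - s = l *\<^sub>R (t - s)"
    proof (cases "t$1 = s$1")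
      case True
      then have "t$2 \<noteq> s$2"
        using assms by (auto simp: vec_eq_iff forall_2)
      then show ?thesis
        using that True unfolding u
        by (intro exI[of _ "(p$2 - s$2) / (t$2 - s$2)"]) (simp add: vec_eq_iff forall_2)
    next
      case False
      then have "t$1 - s$1 \<noteq> 0"
        by simp
      moreover have "(p$2 - s$2) * (t$1 - s$1) = (p$1 - s$1) * (t$2 - s$2)"
        using that unfolding u by (simp add: algebra_simps)
      ultimately show ?thesis
        by (intro exI[of _ "(p$1 - s$1) / (t$1 - s$1)"])
          (simp add: vec_eq_iff forall_2 nonzero_eq_divide_eq)
    qed
    then have "collinear {0, t - s, p - s}"
      using collinear_lemma by blast
    then show ?thesis
      by (simp add: collinear_3[of t s p] insert_commute[of s t])
  qed
  moreover have "u \<bullet> t = u \<bullet> s"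
    unfolding u by (simp add: algebra_simps)
  ultimately show ?thesis
    using that by blast
qed

text \<open>The first case arises when an endpoint lies on both chosen sides, in particular when the
  chord runs along one of them. Otherwise the line through the chord leaves \<open>P\<close> at both
  endpoints.\<close>

lemma polygon_chord_cases:
  assumes "polytope P" "aff_dim P = 2" "polygon_chord P c"
  obtains v where "v \<in> c" "v extreme_point_of P"
  | u d where "P \<inter> {x. u \<bullet> x = d} = c"
proof -
  from assms(3) obtain F F' s t where F: "F facet_of P" "F' facet_of P" "F \<noteq> F'"
    and st: "s \<in> F" "t \<in> F'" "s \<noteq> t" and c: "c = closed_segment s t"
    unfolding polygon_chord_def by blast
  have P: "convex P"
    using assms(1) by (rule polytope_imp_convex)
  have face: "F face_of P" "F' face_of P"
    using F by (auto simp: facet_of_def)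
  then have stP: "s \<in> P" "t \<in> P"
    using st by (auto dest: face_of_imp_subset)
  obtain u d where u: "u \<bullet> s = d" "u \<bullet> t = d" "\<And>p. u \<bullet> p = d \<Longrightarrow> collinear {s, t, p}"
    using line_as_hyperplane[OF st(3)] by blast
  show ?thesis
  proof (cases "t \<in> F \<or> s \<in> F'")
    case True
    then show ?thesis
      using that(1)[of s] that(1)[of t] common_point_of_sides_extreme[OF assms(2) F _ _ P] st c by auto
  next
    case False
    have "p \<in> c" if p: "p \<in> P" "u \<bullet> p = d" for p
    proof (rule ccontr)
      assume "p \<notin> c"
      \<comment> \<open>If the line went on inside \<open>P\<close> beyond \<open>s\<close>, then
        \<open>s\<close> would be interior to a segment of \<open>P\<close> ending in
        \<open>t\<close>, and the face \<open>F\<close> would contain \<open>t\<close>; likewise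
        beyond \<open>t\<close> with \<open>F'\<close>.\<close>
      then have "s \<in> open_segment t p \<or> t \<in> open_segment p s"
        using u(3)[OF p(2)] st(3)
        by (auto simp: collinear_between_cases between_mem_segment open_segment_def c
            closed_segment_commute)
      then show False
        using False face_ofD[OF face(1)] face_ofD[OF face(2)] st stP p(1) by metis
    qed
    moreover have "c \<subseteq> P"
      using P stP c by (simp add: closed_segment_subset)
    moreover have "c \<subseteq> {x. u \<bullet> x = d}"
      unfolding c by (rule closed_segment_subset) (use u convex_hyperplane in auto)
    ultimately show ?thesis
      using that(2)[of u d] by blast
  qed
qed

text \<open>\<open>P\<close> is the convex hull of its extreme points; if all of them lay in the
  complementary open half-space, so would \<open>P\<close>.\<close>

lemma extreme_point_in_halfspace:
  fixes P :: "'a :: euclidean_space set"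
  assumes "polytope P" "x \<in> P" "d \<le> u \<bullet> x"
  obtains v where "v extreme_point_of P" "d \<le> u \<bullet> v"
proof (rule ccontr)
  assume "\<not> thesis"
  then have "{v. v extreme_point_of P} \<subseteq> {y. u \<bullet> y < d}"
    using that by force
  then have "convex hull {v. v extreme_point_of P} \<subseteq> {y. u \<bullet> y < d}"
    by (intro hull_minimal convex_halfspace_lt)
  moreover have "P = convex hull {v. v extreme_point_of P}"
    by (rule Krein_Milman_Minkowski[OF polytope_imp_compact[OF assms(1)]
          polytope_imp_convex[OF assms(1)]])
  ultimately show False
    using assms(2,3) by auto
qed

text \<open>Here \<open>K\<close> stands for another chord and decides which part is cut off:
  \<open>R\<close> is the part away from \<open>K\<close>. The last property says that a connected
  set can leave \<open>R\<close> only across \<open>c\<close>.\<close>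

lemma polygon_chord_region:
  assumes "polytope P" "aff_dim P = 2" "polygon_chord P c"
    and K: "connected_set K" "K \<subseteq> P" "K \<inter> c = {}"
  obtains R v where "R \<subseteq> P" "connected_set R" "c \<subseteq> R" "v \<in> R"
    "v extreme_point_of P" "K \<inter> R = {}"
    "\<And>D. connected_set D \<Longrightarrow> D \<subseteq> P \<Longrightarrow> D \<inter> c = {} \<Longrightarrow> D \<inter> R \<noteq> {} \<Longrightarrow> D \<subseteq> R"
  using assms(1-3)
proof (cases rule: polygon_chord_cases)
  case (1 v)
  have "connected_set c" "c \<subseteq> P"
    using assms(3) polytope_imp_convex[OF assms(1)] unfolding polygon_chord_def facet_of_def
    by (auto dest!: face_of_imp_subset simp: closed_segment_subset subset_iff
        intro: closed_segment_subset[THEN subsetD])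
  \<comment> \<open>With \<open>R = c\<close> the last property holds vacuously.\<close>
  then show ?thesis
    using that[of c v] 1 K by blast
next
  case (2 u d)
  note regionI = that
  have conv: "convex P"
    using assms(1) by (rule polytope_imp_convex)
  have "c \<noteq> {}"
    using assms(3) unfolding polygon_chord_def by auto
  \<comment> \<open>By the intermediate value theorem, a connected set with points on both sides of
    the line meets it, and inside \<open>P\<close> the line is just the chord.\<close>
  have cross: "D \<subseteq> {y. e < w \<bullet> y} \<or> D \<subseteq> {y. w \<bullet> y < e}"
    if "connected_set D" "D \<subseteq> P" "D \<inter> c = {}" "P \<inter> {x. w \<bullet> x = e} = c" for D w e
  proof (rule ccontr)
    assume "\<not> ?thesis"
    then have "\<exists>y\<in>D. w \<bullet> y \<le> e" "\<exists>z\<in>D. e \<le> w \<bullet> z"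
      by (simp_all add: subset_iff) (meson not_less)+
    then obtain q where "q \<in> D" "w \<bullet> q = e"
      using connected_ivt_hyperplane[OF \<open>connected_set D\<close>] by metis
    then show False
      using that by blast
  qed
  \<comment> \<open>Stated for any \<open>w\<close> and \<open>e\<close> so that reversing the sign
    of the normal covers both positions of \<open>K\<close>.\<close>
  have region: thesis if we: "P \<inter> {x. w \<bullet> x = e} = c" "K \<inter> {x. e \<le> w \<bullet> x} = {}" for w e
  proof -
    obtain x where "x \<in> P" "w \<bullet> x = e"
      using we(1) \<open>c \<noteq> {}\<close> by blast
    then obtain v where v: "v extreme_point_of P" "e \<le> w \<bullet> v"
      using extreme_point_in_halfspace[OF assms(1), of x e w] by auto
    show thesis
    proof (rule regionI)
      show "connected_set (P \<inter> {x. e \<le> w \<bullet> x})"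
        using conv convex_halfspace_ge[of e w] by (intro convex_connected convex_Int) auto
      show "v \<in> P \<inter> {x. e \<le> w \<bullet> x}"
        using v by (auto simp: extreme_point_of_def)
      fix D
      assume D: "connected_set D" "D \<subseteq> P" "D \<inter> c = {}" "D \<inter> (P \<inter> {x. e \<le> w \<bullet> x}) \<noteq> {}"
      then show "D \<subseteq> P \<inter> {x. e \<le> w \<bullet> x}"
        using cross[OF D(1-3) we(1)] by fastforce
    qed (use we v in auto)
  qed
  from cross[OF K 2] show ?thesis
  proof
    assume "K \<subseteq> {y. d < u \<bullet> y}"
    then show thesis
      using 2 by (intro region[of "- u" "- d"]) auto
  next
    assume "K \<subseteq> {y. u \<bullet> y < d}"
    then show thesis
      using 2 by (intro region[of u d]) auto
  qed
qed

section \<open>Polygon graphs\<close>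

lemma polygon_chords_asteroidal:
  assumes poly: "convex_polygon k P" and S: "\<forall>s \<in> S. polygon_chord P s"
    and int: "intersection_graph_of G S"
    and ast: "asteroidal_set G A" and card: "3 \<le> card A"
  shows "card A \<le> k"
proof -
  have P: "polytope P" "aff_dim P = 2" "card {F. F facet_of P} = k"
    using poly by (auto simp: convex_polygon_def)
  from int obtain f where G: "graph G" and f: "bij_betw f (verts G) S"
    and adj: "\<And>u v. u \<in> verts G \<Longrightarrow> v \<in> verts G \<Longrightarrow> u \<noteq> v \<Longrightarrow>
      u \<rightarrow>\<^bsub>G\<^esub> v \<longleftrightarrow> f u \<inter> f v \<noteq> {}"
    unfolding intersection_graph_of_def by blast
  interpret graph G by fact
  have A: "A \<subseteq> verts G"
    using ast by (simp add: asteroidal_set_def)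
  have chord: "polygon_chord P (f v)" if "v \<in> verts G" for v
    using f S that by (auto simp: bij_betw_def)
  have f_props: "connected_set (f v)" "f v \<subseteq> P" "f v \<noteq> {}" if "v \<in> verts G" for v
    using chord[OF that] polytope_imp_convex[OF P(1)] unfolding polygon_chord_def facet_of_def
    by (auto dest!: face_of_imp_subset intro: closed_segment_subset[THEN subsetD])
  have disj: "f v \<inter> f a = {}" if "v \<in> verts G - closed_neighbourhood G a" "a \<in> A" for v a
    using that adj[of a v] A by (auto simp: closed_neighbourhood_def)
  have "\<exists>R v. R \<subseteq> P \<and> connected_set R \<and> f a \<subseteq> R \<and> v \<in> R \<and> v extreme_point_of P \<and>
      (\<forall>b \<in> A - {a}. f b \<inter> R = {}) \<and>
      (\<forall>D. connected_set D \<longrightarrow> D \<subseteq> P \<longrightarrow> D \<inter> f a = {} \<longrightarrow> D \<inter> R \<noteq> {} \<longrightarrow> D \<subseteq> R)"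
    if a: "a \<in> A" for a
  proof -
    have "\<not> A \<subseteq> {a}"
      using card card_mono[of "{a}" A] by auto
    \<comment> \<open>Any one other element fixes the side to be cut off; the induction below shows
      that the remaining ones lie on the same side as \<open>x\<close>.\<close>
    then obtain x where x: "x \<in> A - {a}"
      by blast
    have x': "x \<in> verts G - closed_neighbourhood G a"
      by (rule asteroidal_set_not_closed_neighbour[OF G ast card a x])
    obtain R v where R: "R \<subseteq> P" "connected_set R" "f a \<subseteq> R" "v \<in> R" "v extreme_point_of P"
      "f x \<inter> R = {}"
      "\<And>D. connected_set D \<Longrightarrow> D \<subseteq> P \<Longrightarrow> D \<inter> f a = {} \<Longrightarrow> D \<inter> R \<noteq> {} \<Longrightarrow> D \<subseteq> R"
    proof (rule polygon_chord_region[OF P(1,2) chord])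
      show "a \<in> verts G"
        using a A by blast
      show "connected_set (f x)" "f x \<subseteq> P" "f x \<inter> f a = {}"
        using f_props[of x] disj[OF x' a] x' by auto
      fix R v
      assume "R \<subseteq> P" "connected_set R" "f a \<subseteq> R" "v \<in> R" "v extreme_point_of P" "f x \<inter> R = {}"
        "\<And>D. connected_set D \<Longrightarrow> D \<subseteq> P \<Longrightarrow> D \<inter> f a = {} \<Longrightarrow> D \<inter> R \<noteq> {} \<Longrightarrow> D \<subseteq> R"
      then show thesis
        by (rule that)
    qed
    have "f b \<inter> R = {}" if b: "b \<in> A - {a}" for b
    proof (rule asteroidal_set_induct[OF G ast a x b, where Q = "\<lambda>v. f v \<inter> R = {}"])
      fix v w
      assume v: "v \<in> verts G - closed_neighbourhood G a"
        and w: "w \<in> verts G - closed_neighbourhood G a"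
        and vw: "v \<rightarrow>\<^bsub>G\<^esub> w" and vR: "f v \<inter> R = {}"
      \<comment> \<open>The chord of \<open>w\<close> touches that of \<open>v\<close>, so it has a
        point outside \<open>R\<close>. As it does not cross \<open>f a\<close>, it cannot meet
        \<open>R\<close> at all.\<close>
      have "f v \<inter> f w \<noteq> {}"
        using adj[of v w] v w vw adj_not_same by blast
      then have "\<not> f w \<subseteq> R"
        using vR by blast
      then show "f w \<inter> R = {}"
        using R(7)[of "f w"] f_props[of w] disj[OF w a] w by blast
    qed (rule R)
    then show ?thesis
      using R by blast
  qed
  then obtain R c where R: "\<And>a. a \<in> A \<Longrightarrow> R a \<subseteq> P \<and> connected_set (R a) \<and> f a \<subseteq> R a \<and> c a \<in> R a \<and>
      c a extreme_point_of P \<and> (\<forall>b \<in> A - {a}. f b \<inter> R a = {}) \<and>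
      (\<forall>D. connected_set D \<longrightarrow> D \<subseteq> P \<longrightarrow> D \<inter> f a = {} \<longrightarrow> D \<inter> R a \<noteq> {} \<longrightarrow> D \<subseteq> R a)"
    by metis
  \<comment> \<open>The connected set \<open>R b\<close> misses \<open>f a\<close>, so if it met
    \<open>R a\<close> it would lie inside it, and so would \<open>f b\<close>, which misses
    \<open>R a\<close>.\<close>
  have "R b \<inter> R a = {}" if ab: "a \<in> A" "b \<in> A" "a \<noteq> b" for a b
  proof (rule ccontr)
    assume "R b \<inter> R a \<noteq> {}"
    moreover have "R b \<inter> f a = {}"
      using R[OF ab(2)] ab by blast
    ultimately have "R b \<subseteq> R a"
      using R[OF ab(1)] R[OF ab(2)] by simp
    moreover have "f b \<inter> R a = {}" "f b \<noteq> {}"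
      using R[OF ab(1)] f_props(3)[of b] ab A by auto
    moreover have "f b \<subseteq> R b"
      using R[OF ab(2)] by simp
    ultimately show False
      by blast
  qed
  moreover have "c a \<in> R a" if "a \<in> A" for a
    using R[OF that] by simp
  ultimately have "inj_on c A"
    by (intro inj_onI) (metis disjoint_iff)
  moreover have "c ` A \<subseteq> {v. v extreme_point_of P}"
    using R by blast
  ultimately have "card A \<le> card {v. v extreme_point_of P}"
    using finite_extreme_points[OF P(1)] by (intro card_inj_on_le)
  also have "\<dots> \<le> k"
    using polygon_corners_le_sides[OF P(1,2)] P(3) by simp
  finally show ?thesis .
qed

lemma polygon_graph_asteroidal:
  assumes "polygon_graph k G" "asteroidal_set G A"
  shows "card A \<le> k"
  using assms(1) unfolding polygon_graph_def
proof (elim disjE conjE exE)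
  assume "k = 2" "permutation_graph G"
  then show ?thesis
    using permutation_graph_asteroidal assms(2) by blast
next
  fix P S
  assume k: "3 \<le> k" and P: "convex_polygon k P" "\<forall>s\<in>S. polygon_chord P s"
    "intersection_graph_of G S"
  show ?thesis
  proof (cases "3 \<le> card A")
    case True
    then show ?thesis
      by (rule polygon_chords_asteroidal[OF P assms(2)])
  qed (use k in simp)
qed

section \<open>Circle graphs\<close>

text \<open>Balls are strictly convex: an interior point of a segment is closer to \<open>c\<close>
  than one of the segment's ends.\<close>

lemma extreme_point_of_subset_cball:
  fixes P :: "'a :: euclidean_space set"
  assumes "P \<subseteq> cball c r" "x \<in> P" "dist c x = r"
  shows "x extreme_point_of P"
  unfolding extreme_point_of_def
proof (intro conjI ballI notI)
  fix a b
  assume "a \<in> P" "b \<in> P" "x \<in> open_segment a b"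
  then show False
    using dist_decreases_open_segment[of x a b c] assms by fastforce
qed (rule assms)

text \<open>Both endpoints are corners of \<open>P\<close>. Two sides meet at each, so the side
  chosen at \<open>b\<close> can differ from the one chosen at \<open>a\<close>.\<close>

lemma circle_chord_polygon_chord:
  assumes "polytope P" "aff_dim P = 2" "P \<subseteq> cball c r" "sphere c r \<inter> s \<subseteq> P" "circle_chord c r s"
  shows "polygon_chord P s"
proof -
  obtain a b where ab: "a \<in> sphere c r" "b \<in> sphere c r" "a \<noteq> b" and s: "s = closed_segment a b"
    using assms(5) unfolding circle_chord_def by blast
  have "a \<in> P" "b \<in> P"
    using ab s assms(4) by auto
  then have "a extreme_point_of P" "b extreme_point_of P"
    using ab extreme_point_of_subset_cball[OF assms(3)] by auto
  then have card: "2 \<le> card {F. F facet_of P \<and> a \<in> F}" "2 \<le> card {F. F facet_of P \<and> b \<in> F}"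
    using two_facets_at_extreme_point[OF assms(1)] assms(2) by simp_all
  then obtain F where F: "F facet_of P" "a \<in> F"
    by (metis (mono_tags, lifting) card.empty empty_Collect_eq not_numeral_le_zero)
  have "\<not> {F. F facet_of P \<and> b \<in> F} \<subseteq> {F}"
    using card(2) card_mono[of "{F}" "{F. F facet_of P \<and> b \<in> F}"] by auto
  then obtain F' where "F' facet_of P" "b \<in> F'" "F \<noteq> F'"
    by blast
  then show ?thesis
    using F ab s unfolding polygon_chord_def by blast
qed

lemma circle_graph_polygon_graph:
  assumes "circle_graph G"
  obtains k where "3 \<le> k" "polygon_graph k G"
proof -
  obtain c r S where r: "0 < r" and S: "finite S" "\<forall>s\<in>S. circle_chord c r s"
    and int: "intersection_graph_of G S"
    using assms unfolding circle_graph_def by blast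
  define e1 e2 :: "real^2" where "e1 = r *\<^sub>R axis 1 1" and "e2 = r *\<^sub>R axis 2 1"
  \<comment> \<open>Three points of the circle added to the endpoints, so that the hull is
    two-dimensional with at least three corners even when there are few chords or none.\<close>
  define B where "B = {c + e1, c - e1, c + e2}"
  \<comment> \<open>A chord meets the circle exactly in its endpoints, so \<open>T\<close> consists
    of \<open>B\<close> and all endpoints.\<close>
  define T where "T = B \<union> (\<Union>s\<in>S. sphere c r \<inter> s)"
  define P where "P = convex hull T"
  have "finite (sphere c r \<inter> s)" if s_mem: "s \<in> S" for s
  proof -
    obtain a b where ab: "dist c a = r" "dist c b = r" and s: "s = closed_segment a b"
      using bspec[OF S(2) s_mem] unfolding circle_chord_def by auto
    have "dist c x < r" if "x \<in> open_segment a b" for x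
      using dist_decreases_open_segment[OF that, of c] ab by simp
    then have "sphere c r \<inter> s \<subseteq> {a, b}"
      by (force simp: s closed_segment_eq_open)
    then show ?thesis
      by (rule finite_subset) simp
  qed
  then have "finite T"
    unfolding T_def B_def by (intro finite_UnI finite_UN_I S(1)) auto
  have norms: "norm e1 = r" "norm e2 = r"
    using r by (simp_all add: e1_def e2_def)
  have T: "T \<subseteq> sphere c r"
    using norms by (auto simp: T_def B_def dist_norm)
  have P: "polytope P" "P \<subseteq> cball c r"
    using \<open>finite T\<close> T sphere_cball[of c r] hull_minimal[of T "cball c r" convex]
    unfolding P_def polytope_def by blast+
  have comps: "e1 $ 1 = r" "e1 $ 2 = 0" "e2 $ 1 = 0" "e2 $ 2 = r"
    by (simp_all add: e1_def e2_def axis_def)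
  have "\<not> collinear B"
  proof
    assume "collinear B"
    then obtain u l m
      where l: "(c + e1) - (c - e1) = l *\<^sub>R u" and m: "(c + e2) - (c - e1) = m *\<^sub>R u"
      unfolding B_def collinear_def by blast
    \<comment> \<open>The first difference is horizontal and nonzero, forcing
      \<open>u $ 2 = 0\<close>; the second has vertical component \<open>r\<close>.\<close>
    have "2 * r = l * u $ 1" "0 = l * u $ 2" "r = m * u $ 2"
      using arg_cong[OF l, of "\<lambda>x. x $ 1"] arg_cong[OF l, of "\<lambda>x. x $ 2"]
        arg_cong[OF m, of "\<lambda>x. x $ 2"] comps by simp_all
    then show False
      using r by auto
  qed
  then have "\<not> collinear P"
    using collinear_subset[of P B] hull_subset[of T convex] by (auto simp: P_def T_def)
  then have dim: "aff_dim P = 2"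
    using aff_dim_le_DIM[of P] by (simp add: collinear_aff_dim)
  have "polygon_chord P s" if "s \<in> S" for s
  proof (rule circle_chord_polygon_chord[OF P(1) dim P(2)])
    show "sphere c r \<inter> s \<subseteq> P"
      using hull_subset[of T convex] that by (auto simp: P_def T_def)
  qed (use S that in blast)
  moreover have "3 \<le> card {F. F facet_of P}"
  proof -
    have "c + e1 \<noteq> c - e1" "c + e1 \<noteq> c + e2" "c - e1 \<noteq> c + e2"
      using r comps by (auto simp: vec_eq_iff forall_2)
    then have "3 = card B"
      by (simp add: B_def)
    also have "B \<subseteq> {v. v extreme_point_of P}"
    proof
      fix x
      assume "x \<in> B"
      then have "x \<in> P" "dist c x = r"
        using hull_subset[of T convex] T by (auto simp: P_def T_def)
      then show "x \<in> {v. v extreme_point_of P}"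
        using extreme_point_of_subset_cball[OF P(2)] by simp
    qed
    then have "card B \<le> card {v. v extreme_point_of P}"
      using finite_extreme_points[OF P(1)] by (intro card_mono)
    also have "\<dots> \<le> card {F. F facet_of P}"
      by (rule polygon_corners_le_sides[OF P(1) dim])
    finally show ?thesis .
  qed
  ultimately show ?thesis
    using that[of "card {F. F facet_of P}"] P(1) dim S(1) int
    unfolding polygon_graph_def convex_polygon_def by blast
qed

theorem theorem5:
  fixes G :: "('a, 'b) pre_digraph"
  assumes "circle_graph G"
  shows "polygon_number G \<ge> asteroidal_number G"
proof -
  obtain k where "3 \<le> k" "polygon_graph k G"
    using circle_graph_polygon_graph[OF assms] .
  then have "2 \<le> k \<and> polygon_graph k G"
    by simp
  \<comment> \<open>Some order \<open>k\<close> exists, so the \<open>LEAST\<close> in the polygon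
    number is attained.\<close>
  then have poly: "polygon_graph (polygon_number G) G"
    unfolding polygon_number_def by (metis (mono_tags, lifting) LeastI)
  have "graph G"
    using assms by (auto simp: circle_graph_def intersection_graph_of_def)
  then interpret graph G .
  have "finite {A. asteroidal_set G A}"
    by (rule finite_subset[of _ "Pow (verts G)"]) (auto simp: asteroidal_set_def)
  \<comment> \<open>Bounding \<open>Max\<close> by its members requires a finite nonempty
    set.\<close>
  moreover have "asteroidal_set G {}"
    by (simp add: asteroidal_set_def)
  ultimately show ?thesis
    using polygon_graph_asteroidal[OF poly] unfolding asteroidal_number_def
    by (subst Max_le_iff) auto
qed

end
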